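(* Let $w\ge0$ be an integer. If $w$ is even, the map $\mathrm{LSh}^{(2)}_w\to W_w$, $P\mapsto P|\delta$, is well defined and bijective. If $w$ is odd, the map $\mathrm{LSh}^{(2)}_w\to\mathrm{Hom}_{\mathbb Q}(W_w,\mathbb Q)$ sending $P$ to the functional $Q\mapsto(P,Q)$ is an isomorphism of $\mathbb Q$-vector spaces. In both cases $\dim_{\mathbb Q}\mathrm{LSh}^{(2)}_w=\lfloor\frac{w+2}{3}\rfloor$.
   Context: $V_w$ is the $\mathbb Q$-space of homogeneous polynomials of degree $w$ in $X,Y$. $\mathrm{GL}_2(\mathbb Z)$ acts on the right by $(P|A)(X,Y)=P(aX+bY,cX+dY)$ for $A=\begin{pmatrix}a&b\\c&d\end{pmatrix}$, extended linearly to $\mathbb Q[\mathrm{GL}_2(\mathbb Z)]$. $\varepsilon=\begin{pmatrix}0&1\\1&0\end{pmatrix}$, $\gamma=\begin{pmatrix}0&-1\\1&-1\end{pmatrix}$, $\delta=\begin{pmatrix}1&0\\0&-1\end{pmatrix}$, $\varepsilon'=\delta\varepsilon\delta$, $\gamma'=\delta\gamma\delta$. $\mathrm{LSh}^{(2)}_w=\{P\in V_w: P(X,X+Y)+P(Y,X+Y)=-P(X,-Y),\ P(X,Y)=P(-Y,-X)\}$. $W_w=\{Q\in V_w: Q|(1-\varepsilon')=0,\ Q|(1+\gamma'+\gamma'^2)=0\}$. Pairing: $\langle X^aY^{w-a},X^bY^{w-b}\rangle=(-1)^{a+1}\binom{w}{b}^{-1}\delta_{a,w-b}$ ($0\le a,b\le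 w$, Kronecker delta), extended bilinearly to $V_w\times V_w$, and $(P,Q):=\langle P|\delta,Q\rangle$. *)

theory Defs
  imports "HOL-Analysis.Analysis" "HOL-Computational_Algebra.Polynomial"
begin

text \<open>
  The ring of rational polynomials in two variables is \<open>\<rat>[X][Y]\<close>: the inner variable is \<open>X\<close>,
  the outer one is \<open>Y\<close>.
\<close>

type_synonym bipoly = "rat poly poly"

definition X\<^sub>b :: bipoly where "X\<^sub>b = [:[:0, 1:]:]"

definition Y\<^sub>b :: bipoly where "Y\<^sub>b = [:0, 1:]"

definition bscale :: "rat \<Rightarrow> bipoly \<Rightarrow> bipoly" where
  "bscale c P = smult [:c:] P"

definition bcoeff :: "bipoly \<Rightarrow> nat \<Rightarrow> nat \<Rightarrow> rat" where
  "bcoeff P i j = coeff (coeff P j) i"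

text \<open>\<open>bsubst P U V\<close> is \<open>P(U, V)\<close>.\<close>

definition bsubst :: "bipoly \<Rightarrow> bipoly \<Rightarrow> bipoly \<Rightarrow> bipoly" where
  "bsubst P U V =
     (\<Sum>j\<le>degree P. \<Sum>i\<le>degree (coeff P j). bscale (bcoeff P i j) (U ^ i * V ^ j))"

definition hom_polys :: "nat \<Rightarrow> bipoly set" where
  "hom_polys w = {P. \<forall>i j. bcoeff P i j \<noteq> 0 \<longrightarrow> i + j = w}"

global_interpretation bipoly: vector_space bscale
  by unfold_locales (simp_all add: bscale_def smult_add_right mult.commute
        flip: smult_add_left one_pCons)

definition mat2 :: "int \<Rightarrow> int \<Rightarrow> int \<Rightarrow> int \<Rightarrow> int ^ 2 ^ 2" where
  "mat2 a b c d = vector [vector [a, b], vector [c, d]]"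

definition act :: "bipoly \<Rightarrow> int ^ 2 ^ 2 \<Rightarrow> bipoly" where
  "act P A = bsubst P (of_int (A $ 1 $ 1) * X\<^sub>b + of_int (A $ 1 $ 2) * Y\<^sub>b)
                      (of_int (A $ 2 $ 1) * X\<^sub>b + of_int (A $ 2 $ 2) * Y\<^sub>b)"

definition mat_eps :: "int ^ 2 ^ 2" where "mat_eps = mat2 0 1 1 0"

definition mat_gamma :: "int ^ 2 ^ 2" where "mat_gamma = mat2 0 (-1) 1 (-1)"

definition mat_delta :: "int ^ 2 ^ 2" where "mat_delta = mat2 1 0 0 (-1)"

definition mat_eps' :: "int ^ 2 ^ 2" where
  "mat_eps' = mat_delta ** mat_eps ** mat_delta"

definition mat_gamma' :: "int ^ 2 ^ 2" where
  "mat_gamma' = mat_delta ** mat_gamma ** mat_delta"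

definition LSh2 :: "nat \<Rightarrow> bipoly set" where
  "LSh2 w = {P \<in> hom_polys w.
     bsubst P X\<^sub>b (X\<^sub>b + Y\<^sub>b) + bsubst P Y\<^sub>b (X\<^sub>b + Y\<^sub>b) = - bsubst P X\<^sub>b (- Y\<^sub>b) \<and>
     P = bsubst P (- Y\<^sub>b) (- X\<^sub>b)}"

text \<open>
  The action of the group ring elements \<open>1 - \<epsilon>'\<close> and \<open>1 + \<gamma>' + \<gamma>'\<^sup>2\<close> is written out by linearity.
\<close>

definition W_space :: "nat \<Rightarrow> bipoly set" where
  "W_space w = {Q \<in> hom_polys w.
     Q - act Q mat_eps' = 0 \<and>
     Q + act Q mat_gamma' + act Q (mat_gamma' ** mat_gamma') = 0}"

text \<open>
  The bilinear extension to \<open>V\<^sub>w \<times> V\<^sub>w\<close> of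
  \<open>\<langle>X\<^sup>a Y\<^sup>w\<^sup>-\<^sup>a, X\<^sup>b Y\<^sup>w\<^sup>-\<^sup>b\<rangle> = (-1)\<^sup>a\<^sup>+\<^sup>1 (w choose b)\<^sup>-\<^sup>1 \<delta>\<^sub>a\<^sub>,\<^sub>w\<^sub>-\<^sub>b\<close>; only meaningful on \<open>hom_polys w\<close>.
\<close>

definition mono_pairing :: "nat \<Rightarrow> nat \<Rightarrow> nat \<Rightarrow> rat" where
  "mono_pairing w a b =
     (-1) ^ (a + 1) * inverse (of_nat (w choose b)) * (if a = w - b then 1 else 0)"

definition pairing :: "nat \<Rightarrow> bipoly \<Rightarrow> bipoly \<Rightarrow> rat" where
  "pairing w P Q =
     (\<Sum>a\<le>w. \<Sum>b\<le>w. bcoeff P a (w - a) * bcoeff Q b (w - b) * mono_pairing w a b)"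

definition twisted_pairing :: "nat \<Rightarrow> bipoly \<Rightarrow> bipoly \<Rightarrow> rat" where
  "twisted_pairing w P Q = pairing w (act P mat_delta) Q"

text \<open>
  The dual space \<open>Hom(U, \<rat>)\<close> of a subspace \<open>U\<close>. Functionals are made extensional
  (\<open>undefined\<close> outside \<open>U\<close>), so that equality of functions is equality on \<open>U\<close>.
\<close>

definition dual_space :: "bipoly set \<Rightarrow> (bipoly \<Rightarrow> rat) set" where
  "dual_space U = {f \<in> extensional U.
     (\<forall>P\<in>U. \<forall>Q\<in>U. f (P + Q) = f P + f Q) \<and>
     (\<forall>c. \<forall>P\<in>U. f (bscale c P) = c * f P)}"

definition iso_to_dual :: "(bipoly \<Rightarrow> bipoly \<Rightarrow> rat) \<Rightarrow> bipoly set \<Rightarrow> bipoly set \<Rightarrow> bool" where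
  "iso_to_dual \<Phi> L U \<longleftrightarrow>
     bij_betw \<Phi> L (dual_space U) \<and>
     (\<forall>P\<in>L. \<forall>P'\<in>L. \<Phi> (P + P') = (\<lambda>Q\<in>U. \<Phi> P Q + \<Phi> P' Q)) \<and>
     (\<forall>c. \<forall>P\<in>L. \<Phi> (bscale c P) = (\<lambda>Q\<in>U. c * \<Phi> P Q))"

lemma bcoeff_simps [simp]:
  "bcoeff 0 i j = 0"
  "bcoeff (P + Q) i j = bcoeff P i j + bcoeff Q i j"
  "bcoeff (bscale c P) i j = c * bcoeff P i j"
  by (simp_all add: bcoeff_def bscale_def)

lemma bsubst_hom:
  assumes "P \<in> hom_polys w"
  shows "bsubst P U V = (\<Sum>a\<le>w. bscale (bcoeff P a (w - a)) (U ^ a * V ^ (w - a)))"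
proof -
  let ?t = "\<lambda>i j. bscale (bcoeff P i j) (U ^ i * V ^ j)"
  have z: "bcoeff P i j = 0" if "i + j \<noteq> w" for i j
    using assms that by (auto simp: hom_polys_def)
  have dc: "degree (coeff P j) \<le> w" for j
    by (rule degree_le) (use z in \<open>auto simp: bcoeff_def\<close>)
  have dP: "degree P \<le> w"
    by (rule degree_le) (use z in \<open>auto simp: bcoeff_def poly_eq_iff\<close>)
  have inner: "(\<Sum>i\<le>degree (coeff P j). ?t i j) = (\<Sum>i\<le>w. ?t i j)" for j
    by (rule sum.mono_neutral_left)
       (use dc in \<open>auto simp: bcoeff_def coeff_eq_0\<close>)
  have "bsubst P U V = (\<Sum>j\<le>degree P. \<Sum>i\<le>w. ?t i j)"
    by (simp add: bsubst_def inner)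
  also have "\<dots> = (\<Sum>j\<le>w. \<Sum>i\<le>w. ?t i j)"
    by (rule sum.mono_neutral_left)
       (use dP in \<open>auto simp: bcoeff_def coeff_eq_0\<close>)
  also have "\<dots> = (\<Sum>i\<le>w. \<Sum>j\<le>w. ?t i j)"
    by (rule sum.swap)
  also have "\<dots> = (\<Sum>i\<le>w. ?t i (w - i))"
  proof (rule sum.cong [OF refl])
    fix i assume "i \<in> {..w}"
    then have "?t i j = (if j = w - i then ?t i (w - i) else 0)" for j
      using z [of i j] by auto
    then have "(\<Sum>j\<le>w. ?t i j) = (\<Sum>j\<le>w. if j = w - i then ?t i (w - i) else 0)"
      by (intro sum.cong) auto
    then show "(\<Sum>j\<le>w. ?t i j) = ?t i (w - i)" by simp
  qed
  finally show ?thesis .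
qed

lemma hom_polys_subspace: "bipoly.subspace (hom_polys w)"
  unfolding bipoly.subspace_def hom_polys_def by (auto) (metis add_0)+

lemma bsubst_add:
  "P \<in> hom_polys w \<Longrightarrow> Q \<in> hom_polys w \<Longrightarrow>
     bsubst (P + Q) U V = bsubst P U V + bsubst Q U V"
  using bipoly.subspace_add [OF hom_polys_subspace, of P w Q]
  by (simp add: bsubst_hom bipoly.scale_left_distrib sum.distrib)

lemma bsubst_scale:
  "P \<in> hom_polys w \<Longrightarrow> bsubst (bscale c P) U V = bscale c (bsubst P U V)"
  using bipoly.subspace_scale [OF hom_polys_subspace, of P w c]
  by (simp add: bsubst_hom bipoly.scale_sum_right)

lemma bsubst_zero: "bsubst 0 U V = 0"
  by (simp add: bsubst_def)

lemma LSh2_subspace: "bipoly.subspace (LSh2 w)"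
  unfolding bipoly.subspace_def
proof (intro conjI ballI allI)
  show "0 \<in> LSh2 w"
    using bipoly.subspace_0 [OF hom_polys_subspace] by (simp add: LSh2_def bsubst_zero)
next
  fix P Q assume "P \<in> LSh2 w" "Q \<in> LSh2 w"
  then show "P + Q \<in> LSh2 w"
    using bipoly.subspace_add [OF hom_polys_subspace]
    by (auto simp: LSh2_def bsubst_add algebra_simps)
next
  fix c P assume "P \<in> LSh2 w"
  then show "bscale c P \<in> LSh2 w"
    using bipoly.subspace_scale [OF hom_polys_subspace]
    by (auto simp: LSh2_def bsubst_scale simp flip: bipoly.scale_right_distrib)
qed

lemma W_space_subspace: "bipoly.subspace (W_space w)"
  unfolding bipoly.subspace_def
proof (intro conjI ballI allI)
  show "0 \<in> W_space w"
    using bipoly.subspace_0 [OF hom_polys_subspace] by (simp add: W_space_def act_def bsubst_zero)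
next
  fix P Q assume *: "P \<in> W_space w" "Q \<in> W_space w"
  then have "act (P + Q) A = act P A + act Q A" for A
    by (auto simp: W_space_def act_def intro: bsubst_add)
  moreover have "P + Q + (a + b) + (c + d) = (P + a + c) + (Q + b + d)" for a b c d
    by simp
  ultimately show "P + Q \<in> W_space w"
    using * bipoly.subspace_add [OF hom_polys_subspace] by (simp add: W_space_def)
next
  fix c P assume *: "P \<in> W_space w"
  then have "act (bscale c P) A = bscale c (act P A)" for A
    by (auto simp: W_space_def act_def intro: bsubst_scale)
  then show "bscale c P \<in> W_space w"
    using * bipoly.subspace_scale [OF hom_polys_subspace]
    by (simp add: W_space_def flip: bipoly.scale_right_distrib)
qed

end

theory Submission
  imports Defs
begin

text \<open>
  Put \<open>R = P|\<delta>\<close>. The relations defining \<open>LSh2\<close> say that \<open>R\<close> is fixed by the swap \<open>\<epsilon>\<close> and killed by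
  \<open>1 + \<gamma>' + \<gamma>'\<^sup>2\<close>; for \<open>W\<close> the swap is replaced by \<open>\<epsilon>' = -\<epsilon>\<close>, which acts in the same way when \<open>w\<close>
  is even.

  For the dimension, write \<open>t = -u - v\<close>, so that \<open>\<gamma>'\<close> permutes \<open>u, v, t\<close> cyclically. A polynomial \<open>R\<close> as
  above with \<open>R(1, 0) = 0\<close> vanishes on the three lines \<open>u v t = 0\<close>, hence is \<open>u v t\<close> times a polynomial
  of the same kind of degree \<open>w - 3\<close>, and \<open>u\<^sup>w + v\<^sup>w - 2 t\<^sup>w\<close> does not vanish at \<open>(1, 0)\<close> when
  \<open>w > 0\<close>. So the dimension grows by one whenever \<open>w\<close> grows by three.

  For the duality, \<open>\<langle>(x X + y Y)\<^sup>w, Q\<rangle> = -Q(y, -x)\<close>, so the adjoint of \<open>|A\<close> is the action of the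
  adjugate of \<open>A\<close>. Under this adjunction the projections of \<open>V\<^sub>w\<close> onto the two spaces correspond to
  each other, and the perfectness of the pairing on \<open>V\<^sub>w\<close> descends to them.
\<close>

section \<open>Evaluation at rational points\<close>

definition beval :: "bipoly \<Rightarrow> rat \<Rightarrow> rat \<Rightarrow> rat" where
  "beval P u v = poly (poly P [:v:]) u"

lemma beval_simps [simp]:
  "beval 0 u v = 0"
  "beval 1 u v = 1"
  "beval (P + Q) u v = beval P u v + beval Q u v"
  "beval (P - Q) u v = beval P u v - beval Q u v"
  "beval (- P) u v = - beval P u v"
  "beval (P * Q) u v = beval P u v * beval Q u v"
  "beval (P ^ n) u v = beval P u v ^ n"
  "beval (bscale c P) u v = c * beval P u v"
  "beval X\<^sub>b u v = u"
  "beval Y\<^sub>b u v = v"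
  by (simp_all add: beval_def bscale_def X\<^sub>b_def Y\<^sub>b_def)

lemma beval_sum [simp]: "beval (sum f A) u v = (\<Sum>a\<in>A. beval (f a) u v)"
  by (induction A rule: infinite_finite_induct) simp_all

lemma beval_of_int [simp]: "beval (of_int k) u v = of_int k"
  by (simp add: beval_def of_int_poly)

lemma beval_altdef:
  "beval P u v = (\<Sum>j\<le>degree P. \<Sum>i\<le>degree (coeff P j). bcoeff P i j * (u ^ i * v ^ j))"
proof -
  have "beval P u v = (\<Sum>j\<le>degree P. poly (coeff P j * [:v:] ^ j) u)"
    by (simp add: beval_def poly_altdef [of P] poly_sum)
  also have "\<dots> = (\<Sum>j\<le>degree P. poly (coeff P j) u * v ^ j)"
    by simp
  finally show ?thesis
    by (simp add: poly_altdef bcoeff_def sum_distrib_right mult.assoc)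
qed

lemma beval_bsubst [simp]: "beval (bsubst P U V) u v = beval P (beval U u v) (beval V u v)"
  by (simp add: bsubst_def beval_altdef [of P])

lemma beval_eqI:
  assumes "\<And>u v. beval P u v = beval Q u v"
  shows "P = Q"
proof (rule ccontr)
  assume "P \<noteq> Q"
  then have "finite {x. poly (P - Q) x = 0}"
    by (intro poly_roots_finite) simp
  moreover have "poly (poly (P - Q) [:v:]) u = 0" for u v
    using assms [of u v] by (simp add: beval_def)
  then have "range (\<lambda>v. [:v:]) \<subseteq> {x. poly (P - Q) x = 0}"
    using poly_all_0_iff_0 by blast
  moreover have "infinite (range (\<lambda>v::rat. [:v:]))"
    by (simp add: finite_image_iff inj_def infinite_UNIV_char_0)
  ultimately show False
    using finite_subset by blast
qed

lemma beval_eq_iff: "P = Q \<longleftrightarrow> (\<forall>u v. beval P u v = beval Q u v)"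
  using beval_eqI by blast

section \<open>Homogeneous polynomials\<close>

lemma beval_hom_polys:
  assumes "P \<in> hom_polys w"
  shows "beval P u v = (\<Sum>a\<le>w. bcoeff P a (w - a) * (u ^ a * v ^ (w - a)))"
proof -
  have "beval P u v = beval (bsubst P X\<^sub>b Y\<^sub>b) u v"
    by simp
  then show ?thesis
    by (simp add: bsubst_hom [OF assms] del: beval_bsubst)
qed

lemma beval_hom_polys_scale:
  assumes "P \<in> hom_polys w"
  shows "beval P (t * u) (t * v) = t ^ w * beval P u v"
proof -
  have "(t * u) ^ a * (t * v) ^ (w - a) = t ^ w * (u ^ a * v ^ (w - a))" if "a \<le> w" for a
    using that by (simp add: power_mult_distrib flip: power_add [of t a "w - a"])
  then show ?thesis
    by (simp add: beval_hom_polys [OF assms] sum_distrib_left mult.left_commute)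
qed

lemma hom_polys_Int_eq_0: "P \<in> hom_polys m \<Longrightarrow> P \<in> hom_polys n \<Longrightarrow> m \<noteq> n \<Longrightarrow> P = 0"
  by (fastforce simp: hom_polys_def bcoeff_def poly_eq_iff)

lemma hom_polys_add: "P \<in> hom_polys w \<Longrightarrow> Q \<in> hom_polys w \<Longrightarrow> P + Q \<in> hom_polys w"
  and hom_polys_scale: "P \<in> hom_polys w \<Longrightarrow> bscale c P \<in> hom_polys w"
  and hom_polys_uminus: "P \<in> hom_polys w \<Longrightarrow> - P \<in> hom_polys w"
  and hom_polys_diff: "P \<in> hom_polys w \<Longrightarrow> Q \<in> hom_polys w \<Longrightarrow> P - Q \<in> hom_polys w"
  and hom_polys_sum: "(\<And>a. a \<in> A \<Longrightarrow> f a \<in> hom_polys w) \<Longrightarrow> sum f A \<in> hom_polys w"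
  using hom_polys_subspace
  by (auto intro: bipoly.subspace_add bipoly.subspace_scale bipoly.subspace_neg
      bipoly.subspace_diff bipoly.subspace_sum)

lemma hom_polys_mult:
  assumes "P \<in> hom_polys m" "Q \<in> hom_polys n"
  shows "P * Q \<in> hom_polys (m + n)"
  unfolding hom_polys_def
proof (intro CollectI allI impI)
  fix i j
  assume "bcoeff (P * Q) i j \<noteq> 0"
  then have "(\<Sum>k\<le>j. \<Sum>l\<le>i. bcoeff P l k * bcoeff Q (i - l) (j - k)) \<noteq> 0"
    by (simp add: bcoeff_def coeff_mult coeff_sum)
  then obtain k l where "k \<le> j" "l \<le> i" "bcoeff P l k * bcoeff Q (i - l) (j - k) \<noteq> 0"
    by (meson atMost_iff sum.not_neutral_contains_not_neutral)
  then show "i + j = m + n"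
    using assms by (fastforce simp: hom_polys_def)
qed

lemma one_in_hom_polys: "1 \<in> hom_polys 0"
  by (auto simp: hom_polys_def bcoeff_def coeff_1 split: if_splits)

lemma hom_polys_power: "P \<in> hom_polys m \<Longrightarrow> P ^ n \<in> hom_polys (m * n)"
  by (induction n) (auto simp: one_in_hom_polys hom_polys_mult)

lemma X_in_hom_polys: "X\<^sub>b \<in> hom_polys 1"
  and Y_in_hom_polys: "Y\<^sub>b \<in> hom_polys 1"
  by (auto simp: hom_polys_def bcoeff_def X\<^sub>b_def Y\<^sub>b_def coeff_pCons split: nat.splits if_splits)

lemma hom_polys_power_mult_power:
  assumes "U \<in> hom_polys m" "V \<in> hom_polys m" "a \<le> w"
  shows "U ^ a * V ^ (w - a) \<in> hom_polys (m * w)"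
  using hom_polys_mult [OF hom_polys_power [OF assms(1)] hom_polys_power [OF assms(2)], of a "w - a"]
    assms(3) by (simp flip: distrib_left)

lemma hom_polys_bsubst:
  assumes "P \<in> hom_polys w" "U \<in> hom_polys m" "V \<in> hom_polys m"
  shows "bsubst P U V \<in> hom_polys (m * w)"
  unfolding bsubst_hom [OF assms(1)]
  using assms by (intro hom_polys_sum hom_polys_scale hom_polys_power_mult_power) auto

definition hom_poly :: "nat \<Rightarrow> (nat \<Rightarrow> rat) \<Rightarrow> bipoly" where
  "hom_poly w c = (\<Sum>a\<le>w. bscale (c a) (X\<^sub>b ^ a * Y\<^sub>b ^ (w - a)))"

lemma monomial_in_hom_polys: "a \<le> w \<Longrightarrow> X\<^sub>b ^ a * Y\<^sub>b ^ (w - a) \<in> hom_polys w"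
  using hom_polys_power_mult_power [OF X_in_hom_polys Y_in_hom_polys] by simp

lemma hom_poly_in_hom_polys: "hom_poly w c \<in> hom_polys w"
  unfolding hom_poly_def by (intro hom_polys_sum hom_polys_scale monomial_in_hom_polys) simp

lemma bcoeff_monomial: "bcoeff (X\<^sub>b ^ a * Y\<^sub>b ^ b) i j = (if i = a \<and> j = b then 1 else 0)"
proof -
  have "X\<^sub>b ^ a = [:monom 1 a:]" "Y\<^sub>b ^ b = monom 1 b"
    by (simp_all add: X\<^sub>b_def Y\<^sub>b_def monom_altdef poly_const_pow)
  then show ?thesis
    by (auto simp: smult_monom bcoeff_def)
qed

lemma bcoeff_sum: "bcoeff (sum f A) i j = (\<Sum>a\<in>A. bcoeff (f a) i j)"
  by (induction A rule: infinite_finite_induct) simp_all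

lemma bcoeff_hom_poly [simp]:
  assumes "a \<le> w"
  shows "bcoeff (hom_poly w c) a (w - a) = c a"
proof -
  have "bcoeff (hom_poly w c) a (w - a) = (\<Sum>k\<le>w. if k = a then c a else 0)"
    unfolding hom_poly_def bcoeff_sum by (intro sum.cong) (auto simp: bcoeff_monomial)
  then show ?thesis
    using assms by simp
qed

lemma beval_hom_poly [simp]: "beval (hom_poly w c) u v = (\<Sum>a\<le>w. c a * (u ^ a * v ^ (w - a)))"
  by (simp add: hom_poly_def)

lemma hom_polys_expand: "P \<in> hom_polys w \<Longrightarrow> P = hom_poly w (\<lambda>a. bcoeff P a (w - a))"
  by (intro beval_eqI) (simp add: beval_hom_polys)

section \<open>Linear substitutions\<close>

definition lin_form :: "rat \<Rightarrow> rat \<Rightarrow> bipoly" where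
  "lin_form a b = bscale a X\<^sub>b + bscale b Y\<^sub>b"

lemma beval_lin_form [simp]: "beval (lin_form a b) u v = a * u + b * v"
  by (simp add: lin_form_def)

lemma lin_form_in_hom_polys: "lin_form a b \<in> hom_polys 1"
  unfolding lin_form_def by (intro hom_polys_add hom_polys_scale X_in_hom_polys Y_in_hom_polys)

lemma lin_form_power_in_hom_polys: "lin_form a b ^ n \<in> hom_polys n"
  using hom_polys_power [OF lin_form_in_hom_polys] by simp

lemma lin_form_power_eq_hom_poly:
  "lin_form a b ^ w = hom_poly w (\<lambda>k. of_nat (w choose k) * a ^ k * b ^ (w - k))"
  by (intro beval_eqI) (simp add: binomial_ring power_mult_distrib algebra_simps)

definition linsub :: "bipoly \<Rightarrow> rat \<Rightarrow> rat \<Rightarrow> rat \<Rightarrow> rat \<Rightarrow> bipoly" where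
  "linsub P a b c d = bsubst P (lin_form a b) (lin_form c d)"

lemma beval_linsub [simp]: "beval (linsub P a b c d) u v = beval P (a * u + b * v) (c * u + d * v)"
  by (simp add: linsub_def)

lemma linsub_in_hom_polys: "P \<in> hom_polys w \<Longrightarrow> linsub P a b c d \<in> hom_polys w"
  using hom_polys_bsubst [OF _ lin_form_in_hom_polys lin_form_in_hom_polys] by (simp add: linsub_def)

lemma linsub_add: "linsub (P + Q) a b c d = linsub P a b c d + linsub Q a b c d"
  and linsub_scale: "linsub (bscale r P) a b c d = bscale r (linsub P a b c d)"
  and linsub_mult: "linsub (P * Q) a b c d = linsub P a b c d * linsub Q a b c d"
  and linsub_power: "linsub (P ^ n) a b c d = linsub P a b c d ^ n"
  and linsub_lin_form: "linsub (lin_form x y) a b c d = lin_form (x * a + y * c) (x * b + y * d)"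
  and linsub_linsub: "linsub (linsub P a b c d) a' b' c' d' =
    linsub P (a * a' + b * c') (a * b' + b * d') (c * a' + d * c') (c * b' + d * d')"
  and linsub_id: "linsub P 1 0 0 1 = P"
  by (intro beval_eqI; simp add: algebra_simps)+

lemma Y_dvd_hom_polys:
  assumes P: "P \<in> hom_polys w" and zero: "beval P 1 0 = 0"
  obtains S where "S \<in> hom_polys (w - 1)" "P = lin_form 0 1 * S"
proof -
  have "beval P u 0 = 0" for u
    using beval_hom_polys_scale [OF P, of u 1 0] zero by simp
  then have "poly (coeff P 0) u = 0" for u
    by (simp add: beval_def poly_0_coeff_0)
  then have "coeff P 0 = 0"
    using poly_all_0_iff_0 by blast
  then obtain S where S: "P = pCons 0 S"
    by (cases P) simp
  show thesis
  proof
    show "P = lin_form 0 1 * S"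
      by (simp add: S lin_form_def bscale_def Y\<^sub>b_def flip: one_pCons)
    have "bcoeff S i j = bcoeff P i (Suc j)" for i j
      by (simp add: S bcoeff_def)
    then show "S \<in> hom_polys (w - 1)"
      using P by (fastforce simp: hom_polys_def)
  qed
qed

lemma lin_form_dvd_hom_polys:
  assumes P: "P \<in> hom_polys w" and zero: "beval P x y = 0" and xy: "x \<noteq> 0 \<or> y \<noteq> 0"
  obtains S where "S \<in> hom_polys (w - 1)" "P = lin_form (- y) x * S"
proof -
  obtain z t where det: "x * t - y * z = 1"
  proof (cases "x = 0")
    case True
    then show thesis
      using xy that [of 0 "- 1 / y"] by simp
  next
    case False
    then show thesis
      using that [of "1 / x" 0] by simp
  qed
  have "beval (linsub P x z y t) 1 0 = 0"
    using zero by simp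
  then obtain T where T: "T \<in> hom_polys (w - 1)" "linsub P x z y t = lin_form 0 1 * T"
    by (rule Y_dvd_hom_polys [OF linsub_in_hom_polys [OF P]])
  have "P = linsub (linsub P x z y t) t (- z) (- y) x"
    using det linsub_id [of P] by (simp add: linsub_linsub algebra_simps)
  also have "\<dots> = lin_form (- y) x * linsub T t (- z) (- y) x"
    by (simp add: T linsub_mult linsub_lin_form)
  finally show thesis
    using that linsub_in_hom_polys [OF T(1)] by blast
qed

section \<open>Period spaces\<close>

text \<open>The parameter \<open>s = \<plusminus>1\<close> is the sign of the swap; the other two substitutions are \<open>\<gamma>'\<close> and \<open>\<gamma>'\<^sup>2\<close>.\<close>

definition period_space :: "rat \<Rightarrow> nat \<Rightarrow> bipoly set" where
  "period_space s w = {R \<in> hom_polys w.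
     linsub R 0 s s 0 = R \<and> R + linsub R 0 1 (-1) (-1) + linsub R (-1) (-1) 1 0 = 0}"

lemma mem_period_space_iff:
  "R \<in> period_space s w \<longleftrightarrow> R \<in> hom_polys w \<and>
     (\<forall>u v. beval R (s * v) (s * u) = beval R u v) \<and>
     (\<forall>u v. beval R u v + beval R v (- u - v) + beval R (- u - v) u = 0)"
  by (simp add: period_space_def beval_eq_iff)

lemma period_space_subspace: "bipoly.subspace (period_space s w)"
  unfolding bipoly.subspace_def
  by (auto simp: mem_period_space_iff hom_polys_add hom_polys_scale add_eq_0_iff
      bipoly.subspace_0 [OF hom_polys_subspace] simp flip: distrib_left)

lemma period_space_uminus_even:
  assumes "even w"
  shows "period_space (- s) w = period_space s w"
proof -
  have "beval R (- (s * v)) (- (s * u)) = beval R (s * v) (s * u)" if "R \<in> hom_polys w" for R u v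
    using beval_hom_polys_scale [OF that, of "-1"] assms by simp
  then show ?thesis
    by (auto simp: mem_period_space_iff)
qed

lemma beval_act_mat2:
  "beval (act P (mat2 a b c d)) u v =
     beval P (of_int a * u + of_int b * v) (of_int c * u + of_int d * v)"
  by (simp add: act_def mat2_def)

lemma mat2_mult:
  "mat2 a b c d ** mat2 a' b' c' d' =
     mat2 (a * a' + b * c') (a * b' + b * d') (c * a' + d * c') (c * b' + d * d')"
  by (simp add: mat2_def matrix_matrix_mult_def vec_eq_iff forall_2 sum_2)

lemma beval_act_simps [simp]:
  "beval (act P mat_delta) u v = beval P u (- v)"
  "beval (act P mat_eps') u v = beval P (- v) (- u)"
  "beval (act P mat_gamma') u v = beval P v (- u - v)"
  "beval (act P (mat_gamma' ** mat_gamma')) u v = beval P (- u - v) u"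
  by (simp_all add: mat_eps'_def mat_gamma'_def mat_delta_def mat_eps_def mat_gamma_def
        mat2_mult beval_act_mat2)

lemma W_space_eq_period_space: "W_space w = period_space (-1) w"
  by (auto simp: W_space_def mem_period_space_iff beval_eq_iff)

lemma act_delta_eq_linsub: "act P mat_delta = linsub P 1 0 0 (-1)"
  by (intro beval_eqI) simp

lemma act_delta_act_delta [simp]: "act (act P mat_delta) mat_delta = P"
  by (intro beval_eqI) simp

lemma act_delta_add: "act (P + Q) mat_delta = act P mat_delta + act Q mat_delta"
  and act_delta_scale: "act (bscale c P) mat_delta = bscale c (act P mat_delta)"
  by (simp_all add: act_delta_eq_linsub linsub_add linsub_scale)

lemma act_delta_mem_LSh2_iff: "act R mat_delta \<in> LSh2 w \<longleftrightarrow> R \<in> period_space 1 w"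
proof -
  have hom: "act R mat_delta \<in> hom_polys w \<longleftrightarrow> R \<in> hom_polys w"
    by (metis act_delta_act_delta act_delta_eq_linsub linsub_in_hom_polys)
  have swap: "(\<forall>u v. beval R u (- v) = beval R (- v) u) \<longleftrightarrow> (\<forall>u v. beval R v u = beval R u v)"
    by (metis minus_minus)
  have cycle: "(\<forall>u v. beval R u (- u - v) + beval R v (- u - v) = - beval R u v) \<longleftrightarrow>
      (\<forall>u v. beval R u v + beval R v (- u - v) + beval R (- u - v) u = 0)"
    if "\<forall>u v. beval R v u = beval R u v"
  proof -
    have "beval R u (- u - v) = beval R (- u - v) u" for u v
      using that by blast
    then show ?thesis
      by (simp add: eq_neg_iff_add_eq_0 add_ac)
  qed
  show ?thesis
    using hom swap cycle by (auto simp: LSh2_def mem_period_space_iff beval_eq_iff)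
qed

lemma LSh2_eq_image_act_delta: "LSh2 w = (\<lambda>R. act R mat_delta) ` period_space 1 w"
proof -
  have "P \<in> (\<lambda>R. act R mat_delta) ` period_space 1 w" if "P \<in> LSh2 w" for P
    using that act_delta_mem_LSh2_iff [of "act P mat_delta"]
    by (intro image_eqI [of _ _ "act P mat_delta"]) simp_all
  then show ?thesis
    by (auto simp: act_delta_mem_LSh2_iff)
qed

lemma bij_betw_act_delta: "bij_betw (\<lambda>P. act P mat_delta) (LSh2 w) (period_space 1 w)"
  unfolding LSh2_eq_image_act_delta
  by (rule bij_betw_byWitness [where f' = "\<lambda>P. act P mat_delta"]) auto

section \<open>The dimension\<close>

definition (in vector_space) has_dimension :: "'b set \<Rightarrow> nat \<Rightarrow> bool" where
  "has_dimension V k \<longleftrightarrow> (\<exists>B. finite B \<and> independent B \<and> span B = V \<and> card B = k)"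

lemma (in vector_space) has_dimension_imp_dim_eq: "has_dimension V k \<Longrightarrow> dim V = k"
  by (auto simp: has_dimension_def dim_eq_card_independent)

lemma (in vector_space) has_dimension_zero: "has_dimension {0} 0"
  unfolding has_dimension_def by (intro exI [of _ "{}"]) (simp add: independent_empty)

lemma (in vector_space) has_dimension_Suc_of_kernel:
  assumes f: "Vector_Spaces.linear scale (*) f" and V: "subspace V"
    and kernel: "has_dimension {x \<in> V. f x = 0} k" and e: "e \<in> V" "f e \<noteq> 0"
  shows "has_dimension V (Suc k)"
proof -
  interpret f: Vector_Spaces.linear scale "(*)" f
    by (rule f)
  obtain B where B: "finite B" "independent B" "span B = {x \<in> V. f x = 0}" "card B = k"
    using kernel by (auto simp: has_dimension_def)
  have "e \<notin> span B"
    using e B by simp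
  then have "e \<notin> B" "independent (insert e B)"
    using B span_base [of e B] by (auto simp: independent_insert)
  moreover have "span (insert e B) = V"
  proof
    show "span (insert e B) \<subseteq> V"
      using e B span_superset [of B] by (intro span_minimal V) auto
    show "V \<subseteq> span (insert e B)"
    proof
      fix x assume x: "x \<in> V"
      have "x - scale (f x / f e) e \<in> span B"
        using x e by (simp add: B V subspace_diff subspace_scale f.diff f.scale)
      then show "x \<in> span (insert e B)"
        by (auto simp: span_insert)
    qed
  qed
  ultimately show ?thesis
    unfolding has_dimension_def using B by (intro exI [of _ "insert e B"]) simp
qed

lemma (in Vector_Spaces.linear) has_dimension_image:
  assumes V: "vs1.has_dimension V k" and inj: "inj_on f V"
  shows "vs2.has_dimension (f ` V) k"
proof -
  obtain B where B: "finite B" "vs1.independent B" "vs1.span B = V" "card B = k"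
    using V by (auto simp: vs1.has_dimension_def)
  then have "vs2.independent (f ` B)"
    using inj by (intro independent_injective_image) simp_all
  moreover have "card (f ` B) = k"
    using B inj vs1.span_superset [of B] by (metis card_image inj_on_subset)
  ultimately show ?thesis
    unfolding vs2.has_dimension_def using B by (intro exI [of _ "f ` B"]) (simp add: span_image)
qed

definition line_product :: bipoly where
  "line_product = X\<^sub>b * Y\<^sub>b * (- X\<^sub>b - Y\<^sub>b)"

lemma beval_line_product [simp]: "beval line_product u v = u * v * (- u - v)"
  by (simp add: line_product_def)

lemma line_product_nonzero: "line_product \<noteq> 0"
  using beval_line_product [of 1 1] by (auto simp del: beval_line_product)

lemma line_product_in_hom_polys: "line_product \<in> hom_polys 3"
proof -
  have "line_product \<in> hom_polys (1 + 1 + 1)"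
    unfolding line_product_def
    by (intro hom_polys_mult hom_polys_diff hom_polys_uminus X_in_hom_polys Y_in_hom_polys)
  then show ?thesis
    by (simp add: numeral_3_eq_3)
qed

lemma line_product_mult_in_period_space_iff:
  assumes "S \<in> hom_polys n"
  shows "line_product * S \<in> period_space 1 (n + 3) \<longleftrightarrow> S \<in> period_space 1 n"
proof -
  have "linsub line_product 0 1 1 0 = line_product" "linsub line_product 0 1 (-1) (-1) = line_product"
    "linsub line_product (-1) (-1) 1 0 = line_product"
    by (intro beval_eqI; simp add: algebra_simps)+
  moreover have "line_product * S \<in> hom_polys (n + 3)"
    using hom_polys_mult [OF line_product_in_hom_polys assms] by (simp add: add.commute)
  ultimately show ?thesis
    using assms line_product_nonzero
    by (simp add: period_space_def linsub_mult flip: distrib_left)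
qed

definition period_kernel :: "nat \<Rightarrow> bipoly set" where
  "period_kernel w = {R \<in> period_space 1 w. beval R 1 0 = 0}"

lemma line_product_dvd_period_kernel:
  assumes R: "R \<in> period_kernel w"
  obtains S where "S \<in> hom_polys (w - 3)" "R = line_product * S"
proof -
  have hom: "R \<in> hom_polys w" and R_1_0: "beval R 1 0 = 0"
    and swap: "\<And>u v. beval R v u = beval R u v"
    and cycle: "\<And>u v. beval R u v + beval R v (- u - v) + beval R (- u - v) u = 0"
    using R by (auto simp: period_kernel_def mem_period_space_iff)
  have R_0_1: "beval R 0 1 = 0"
    using swap [of 0 1] R_1_0 by simp
  have "beval R 0 (-1) = 0"
    using beval_hom_polys_scale [OF hom, of "-1" 0 1] R_0_1 by simp
  then have R_m1_1: "beval R (-1) 1 = 0"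
    using cycle [of 1 0] R_1_0 by simp
  obtain S\<^sub>1 where S\<^sub>1: "S\<^sub>1 \<in> hom_polys (w - 1)" "R = lin_form 0 1 * S\<^sub>1"
    using lin_form_dvd_hom_polys [OF hom R_1_0] by auto
  have S\<^sub>1_zeros: "beval S\<^sub>1 0 1 = 0" "beval S\<^sub>1 (-1) 1 = 0"
    using R_0_1 R_m1_1 by (simp_all add: S\<^sub>1)
  obtain S\<^sub>2 where S\<^sub>2: "S\<^sub>2 \<in> hom_polys (w - 1 - 1)" "S\<^sub>1 = lin_form (-1) 0 * S\<^sub>2"
    using lin_form_dvd_hom_polys [OF S\<^sub>1(1) S\<^sub>1_zeros(1)] by auto
  have "beval S\<^sub>2 (-1) 1 = 0"
    using S\<^sub>1_zeros(2) by (simp add: S\<^sub>2)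
  then obtain S\<^sub>3 where S\<^sub>3: "S\<^sub>3 \<in> hom_polys (w - 1 - 1 - 1)" "S\<^sub>2 = lin_form (-1) (-1) * S\<^sub>3"
    using lin_form_dvd_hom_polys [OF S\<^sub>2(1), of "-1" 1] by auto
  show thesis
  proof
    show "- S\<^sub>3 \<in> hom_polys (w - 3)"
      using hom_polys_uminus [OF S\<^sub>3(1)] by (simp add: numeral_3_eq_3)
    show "R = line_product * - S\<^sub>3"
      by (intro beval_eqI) (simp add: S\<^sub>1 S\<^sub>2 S\<^sub>3 algebra_simps)
  qed
qed

lemma period_kernel_less_3:
  assumes "w < 3"
  shows "period_kernel w = {0}"
proof -
  have "R = 0" if R: "R \<in> period_kernel w" for R
  proof (rule hom_polys_Int_eq_0)
    obtain S where "S \<in> hom_polys (w - 3)" "R = line_product * S"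
      using line_product_dvd_period_kernel [OF R] by blast
    then show "R \<in> hom_polys (3 + (w - 3))"
      by (simp only: hom_polys_mult line_product_in_hom_polys)
    show "R \<in> hom_polys w"
      using R by (simp add: period_kernel_def mem_period_space_iff)
  qed (use assms in simp)
  moreover have "0 \<in> period_kernel w"
    by (simp add: period_kernel_def bipoly.subspace_0 [OF period_space_subspace])
  ultimately show ?thesis by blast
qed

lemma period_kernel_add_3: "period_kernel (n + 3) = (*) line_product ` period_space 1 n"
proof (intro equalityI subsetI)
  fix R assume R: "R \<in> period_kernel (n + 3)"
  then obtain S where S: "S \<in> hom_polys n" "R = line_product * S"
    using line_product_dvd_period_kernel [of R "n + 3"] by auto
  then have "S \<in> period_space 1 n"
    using R by (simp add: period_kernel_def line_product_mult_in_period_space_iff)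
  then show "R \<in> (*) line_product ` period_space 1 n"
    using S by blast
next
  fix R assume "R \<in> (*) line_product ` period_space 1 n"
  then obtain S where S: "S \<in> period_space 1 n" "R = line_product * S"
    by blast
  then have "R \<in> period_space 1 (n + 3)"
    using line_product_mult_in_period_space_iff [of S n] by (simp add: period_space_def)
  then show "R \<in> period_kernel (n + 3)"
    by (simp add: period_kernel_def S)
qed

definition period_power_sum :: "nat \<Rightarrow> bipoly" where
  "period_power_sum n = lin_form 1 0 ^ n + lin_form 0 1 ^ n - bscale 2 (lin_form (-1) (-1) ^ n)"

lemma period_power_sum_in_period_space: "period_power_sum n \<in> period_space 1 n"
proof -
  have "period_power_sum n \<in> hom_polys n"
    unfolding period_power_sum_def
    by (intro hom_polys_diff hom_polys_add hom_polys_scale lin_form_power_in_hom_polys)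
  then show ?thesis
    by (simp add: mem_period_space_iff period_power_sum_def add.commute)
qed

lemma beval_period_power_sum_nonzero: "n > 0 \<Longrightarrow> beval (period_power_sum n) 1 0 \<noteq> 0"
  by (cases "even n") (auto simp: period_power_sum_def power_0_left)

lemma linear_beval: "Vector_Spaces.linear bscale (*) (\<lambda>P. beval P u v)"
  by unfold_locales (simp_all add: algebra_simps)

lemma linear_mult_left: "Vector_Spaces.linear bscale bscale ((*) P)"
  by unfold_locales (simp_all add: algebra_simps bscale_def)

lemma linear_act_delta: "Vector_Spaces.linear bscale bscale (\<lambda>P. act P mat_delta)"
  by unfold_locales (simp_all add: act_delta_add act_delta_scale)

lemma period_space_0: "period_space 1 0 = {0}"
proof -
  have "beval R 1 0 = 0" if R: "R \<in> period_space 1 0" for R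
  proof -
    have "beval R 1 0 + beval R 0 (- 1 - 0) + beval R (- 1 - 0) 1 = 0"
      using R by (auto simp only: mem_period_space_iff)
    moreover have const: "beval R u v = beval R 0 0" for u v
      using R beval_hom_polys_scale [of R 0 0 u v] by (simp add: mem_period_space_iff)
    ultimately show ?thesis
      using const [of 1 0] const [of 0 "-1"] const [of "-1" 1] by simp
  qed
  then show ?thesis
    using period_kernel_less_3 [of 0] by (auto simp: period_kernel_def)
qed

lemma has_dimension_period_kernel_add_3:
  assumes "bipoly.has_dimension (period_space 1 n) k"
  shows "bipoly.has_dimension (period_kernel (n + 3)) k"
proof -
  interpret D: Vector_Spaces.linear bscale bscale "(*) line_product"
    by (rule linear_mult_left)
  have "inj_on ((*) line_product) (period_space 1 n)"
    using line_product_nonzero by (auto simp: inj_on_def)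
  then show ?thesis
    unfolding period_kernel_add_3 by (rule D.has_dimension_image [OF assms])
qed

lemma has_dimension_period_space_Suc:
  assumes "w > 0" "bipoly.has_dimension (period_kernel w) k"
  shows "bipoly.has_dimension (period_space 1 w) (Suc k)"
proof (rule bipoly.has_dimension_Suc_of_kernel)
  show "Vector_Spaces.linear bscale (*) (\<lambda>R. beval R 1 0)"
    by (rule linear_beval)
  show "bipoly.has_dimension {R \<in> period_space 1 w. beval R 1 0 = 0} k"
    using assms by (simp add: period_kernel_def)
  show "beval (period_power_sum w) 1 0 \<noteq> 0"
    using assms(1) by (rule beval_period_power_sum_nonzero)
qed (simp_all add: period_space_subspace period_power_sum_in_period_space)

lemma has_dimension_period_space: "bipoly.has_dimension (period_space 1 w) ((w + 2) div 3)"
proof (induction w rule: less_induct)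
  case (less w)
  consider (zero) "w = 0" | (small) "0 < w" "w < 3" | (add_3) n where "w = n + 3"
    by (metis le_add_diff_inverse2 not_less neq0_conv)
  then show ?case
  proof cases
    case zero
    then show ?thesis
      by (simp add: period_space_0 bipoly.has_dimension_zero)
  next
    case small
    then have "bipoly.has_dimension (period_space 1 w) (Suc 0)"
      by (intro has_dimension_period_space_Suc)
         (simp_all add: period_kernel_less_3 bipoly.has_dimension_zero)
    moreover have "(w + 2) div 3 = Suc 0"
      using small by simp
    ultimately show ?thesis by simp
  next
    case add_3
    then have "bipoly.has_dimension (period_space 1 w) (Suc ((n + 2) div 3))"
      using less.IH [of n]
      by (simp add: has_dimension_period_space_Suc has_dimension_period_kernel_add_3)
    moreover have "(w + 2) div 3 = Suc ((n + 2) div 3)"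
      using add_3 by simp
    ultimately show ?thesis by simp
  qed
qed

lemma dim_LSh2: "bipoly.dim (LSh2 w) = (w + 2) div 3"
proof -
  interpret D: Vector_Spaces.linear bscale bscale "\<lambda>P. act P mat_delta"
    by (rule linear_act_delta)
  have "inj_on (\<lambda>P. act P mat_delta) (period_space 1 w)"
    by (rule inj_on_inverseI [where g = "\<lambda>P. act P mat_delta"]) simp
  then have "bipoly.has_dimension ((\<lambda>P. act P mat_delta) ` period_space 1 w) ((w + 2) div 3)"
    by (rule D.has_dimension_image [OF has_dimension_period_space])
  then show ?thesis
    by (simp add: bipoly.has_dimension_imp_dim_eq LSh2_eq_image_act_delta)
qed

section \<open>The pairing\<close>

lemma pairing_altdef:
  "pairing w P Q =
     (\<Sum>a\<le>w. bcoeff P a (w - a) * bcoeff Q (w - a) a * (-1) ^ (a + 1) / of_nat (w choose a))"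
proof -
  have "(\<Sum>b\<le>w. bcoeff P a (w - a) * bcoeff Q b (w - b) * mono_pairing w a b)
      = bcoeff P a (w - a) * bcoeff Q (w - a) a * (-1) ^ (a + 1) / of_nat (w choose a)"
    (is "?lhs = ?rhs") if "a \<le> w" for a
  proof -
    have "?lhs = (\<Sum>b\<le>w. if b = w - a then ?rhs else 0)"
      using that by (intro sum.cong)
        (auto simp: mono_pairing_def divide_inverse binomial_symmetric [of a w])
    then show ?thesis by simp
  qed
  then show ?thesis
    by (simp add: pairing_def)
qed

lemma bcoeff_diff [simp]: "bcoeff (P - Q) i j = bcoeff P i j - bcoeff Q i j"
  by (simp add: bcoeff_def)

lemma pairing_add_left: "pairing w (P + P') Q = pairing w P Q + pairing w P' Q"
  and pairing_diff_left: "pairing w (P - P') Q = pairing w P Q - pairing w P' Q"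
  and pairing_scale_left: "pairing w (bscale c P) Q = c * pairing w P Q"
  and pairing_add_right: "pairing w P (Q + Q') = pairing w P Q + pairing w P Q'"
  and pairing_diff_right: "pairing w P (Q - Q') = pairing w P Q - pairing w P Q'"
  and pairing_scale_right: "pairing w P (bscale c Q) = c * pairing w P Q"
  by (simp_all add: pairing_def algebra_simps sum.distrib sum_subtractf sum_distrib_left)

lemma pairing_commute: "pairing w P Q = (-1) ^ w * pairing w Q P"
proof -
  have sign: "(-1) ^ (w - a + 1) / of_nat (w choose (w - a)) =
      (-1) ^ w * ((-1) ^ (a + 1) / of_nat (w choose a) :: rat)" if "a \<le> w" for a
    using that by (auto simp: minus_one_power_iff binomial_symmetric [of a w])
  have "pairing w P Q = (\<Sum>a\<le>w. bcoeff P (w - a) a * bcoeff Q a (w - a)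
      * ((-1) ^ (w - a + 1) / of_nat (w choose (w - a))))"
    unfolding pairing_altdef
    by (rule sum.reindex_bij_witness [where i = "\<lambda>a. w - a" and j = "\<lambda>a. w - a"]) auto
  also have "\<dots> = (\<Sum>a\<le>w. (-1) ^ w *
      (bcoeff Q a (w - a) * bcoeff P (w - a) a * (-1) ^ (a + 1) / of_nat (w choose a)))"
    by (intro sum.cong refl) (simp only: sign atMost_iff, simp)
  also have "\<dots> = (-1) ^ w * pairing w Q P"
    unfolding pairing_altdef by (rule sum_distrib_left [symmetric])
  finally show ?thesis .
qed

lemma pairing_lin_form_power_left:
  assumes "Q \<in> hom_polys w"
  shows "pairing w (lin_form x y ^ w) Q = - beval Q y (- x)"
proof -
  have "beval Q y (- x) = (\<Sum>a\<le>w. bcoeff Q (w - a) a * (y ^ (w - a) * (- x) ^ a))"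
    unfolding beval_hom_polys [OF assms]
    by (rule sum.reindex_bij_witness [where i = "\<lambda>a. w - a" and j = "\<lambda>a. w - a"]) auto
  then show ?thesis
    by (auto simp: pairing_altdef lin_form_power_eq_hom_poly power_minus [of x]
        simp flip: sum_negf intro!: sum.cong)
qed

lemma pairing_eqI:
  assumes "R \<in> hom_polys w" "R' \<in> hom_polys w"
    and eq: "\<And>Q. Q \<in> hom_polys w \<Longrightarrow> pairing w R Q = pairing w R' Q"
  shows "R = R'"
proof (rule beval_eqI)
  fix u v
  have "pairing w (lin_form (- v) u ^ w) R = pairing w (lin_form (- v) u ^ w) R'"
    using eq [OF lin_form_power_in_hom_polys]
    by (simp add: pairing_commute [of w "lin_form (- v) u ^ w"])
  then show "beval R u v = beval R' u v"
    using assms by (simp add: pairing_lin_form_power_left)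
qed

section \<open>Duality\<close>

lemma restrict_in_dual_space:
  assumes "bipoly.subspace U"
    and "\<And>P Q. P \<in> U \<Longrightarrow> Q \<in> U \<Longrightarrow> f (P + Q) = f P + f Q"
    and "\<And>c P. P \<in> U \<Longrightarrow> f (bscale c P) = c * f P"
  shows "restrict f U \<in> dual_space U"
  using assms by (simp add: dual_space_def bipoly.subspace_add bipoly.subspace_scale)

lemma dual_space_add: "f \<in> dual_space U \<Longrightarrow> P \<in> U \<Longrightarrow> Q \<in> U \<Longrightarrow> f (P + Q) = f P + f Q"
  and dual_space_scale: "f \<in> dual_space U \<Longrightarrow> P \<in> U \<Longrightarrow> f (bscale c P) = c * f P"
  by (simp_all add: dual_space_def)

lemma dual_space_sum:
  assumes U: "bipoly.subspace U" and f: "f \<in> dual_space U" and "\<And>a. a \<in> A \<Longrightarrow> g a \<in> U"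
  shows "f (sum g A) = (\<Sum>a\<in>A. f (g a))"
  using assms(3)
proof (induction A rule: infinite_finite_induct)
  case (insert a A)
  then show ?case
    using dual_space_add [OF f] by (simp add: bipoly.subspace_sum [OF U])
qed (use dual_space_scale [OF f bipoly.subspace_0 [OF U], of 0] in simp_all)

lemma dual_space_hom_poly:
  assumes "f \<in> dual_space (hom_polys w)"
  shows "f (hom_poly w c) = (\<Sum>a\<le>w. c a * f (X\<^sub>b ^ a * Y\<^sub>b ^ (w - a)))"
  unfolding hom_poly_def
  by (subst dual_space_sum [OF hom_polys_subspace assms])
     (auto simp: dual_space_scale [OF assms] monomial_in_hom_polys hom_polys_scale)

lemma power_sum_coeffs_eqI:
  fixes c d :: "nat \<Rightarrow> 'a :: {idom, ring_char_0}"
  assumes "\<And>x. (\<Sum>k\<le>n. c k * x ^ k) = (\<Sum>k\<le>n. d k * x ^ k)" and "k \<le> n"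
  shows "c k = d k"
proof -
  have "(\<Sum>k\<le>n. monom (c k) k) = (\<Sum>k\<le>n. monom (d k) k)"
    by (simp add: poly_eq_poly_eq_iff [symmetric] fun_eq_iff poly_sum poly_monom assms)
  then have "coeff (\<Sum>k\<le>n. monom (c k) k) k = coeff (\<Sum>k\<le>n. monom (d k) k) k"
    by simp
  then show ?thesis
    using \<open>k \<le> n\<close> by (simp add: coeff_sum)
qed

lemma dual_space_hom_polys_eqI:
  assumes f: "f \<in> dual_space (hom_polys w)" and g: "g \<in> dual_space (hom_polys w)"
    and eq: "\<And>x. f (lin_form x 1 ^ w) = g (lin_form x 1 ^ w)"
  shows "f = g"
proof -
  let ?m = "\<lambda>k. X\<^sub>b ^ k * Y\<^sub>b ^ (w - k)"
  have "(\<Sum>k\<le>w. of_nat (w choose k) * f (?m k) * x ^ k) =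
      (\<Sum>k\<le>w. of_nat (w choose k) * g (?m k) * x ^ k)" for x
    using eq [of x]
    by (simp add: lin_form_power_eq_hom_poly dual_space_hom_poly [OF f] dual_space_hom_poly [OF g]
        mult_ac)
  then have "of_nat (w choose k) * f (?m k) = of_nat (w choose k) * g (?m k)" if "k \<le> w" for k
    using that by (rule power_sum_coeffs_eqI)
  then have monomial: "f (?m k) = g (?m k)" if "k \<le> w" for k
    using that by simp
  have "f P = g P" if "P \<in> hom_polys w" for P
    by (subst (1 2) hom_polys_expand [OF that])
       (simp add: dual_space_hom_poly [OF f] dual_space_hom_poly [OF g] monomial)
  moreover have "f \<in> extensional (hom_polys w)" "g \<in> extensional (hom_polys w)"
    using f g by (simp_all add: dual_space_def)
  ultimately show ?thesis
    by (intro extensionalityI) auto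
qed

text \<open>It suffices to compare both sides on powers of linear forms, where the pairing is evaluation.\<close>

lemma pairing_linsub:
  assumes P: "P \<in> hom_polys w" and Q: "Q \<in> hom_polys w"
  shows "pairing w (linsub P a b c d) Q = pairing w P (linsub Q d (- b) (- c) a)"
proof -
  have "(\<lambda>P\<in>hom_polys w. pairing w (linsub P a b c d) Q) =
      (\<lambda>P\<in>hom_polys w. pairing w P (linsub Q d (- b) (- c) a))"
  proof (rule dual_space_hom_polys_eqI)
    fix x
    show "(\<lambda>P\<in>hom_polys w. pairing w (linsub P a b c d) Q) (lin_form x 1 ^ w) =
        (\<lambda>P\<in>hom_polys w. pairing w P (linsub Q d (- b) (- c) a)) (lin_form x 1 ^ w)"
      using Q by (simp add: lin_form_power_in_hom_polys linsub_power linsub_lin_form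
          pairing_lin_form_power_left linsub_in_hom_polys algebra_simps)
  qed (auto intro!: restrict_in_dual_space hom_polys_subspace
        simp: linsub_add linsub_scale pairing_add_left pairing_scale_left)
  from fun_cong [OF this, of P] show ?thesis
    using P by simp
qed

lemma pairing_represents:
  assumes g: "g \<in> dual_space (hom_polys w)"
  obtains R where "R \<in> hom_polys w" "\<And>Q. Q \<in> hom_polys w \<Longrightarrow> pairing w R Q = g Q"
proof
  let ?R = "hom_poly w (\<lambda>a. (-1) ^ (a + 1) * of_nat (w choose a) * g (X\<^sub>b ^ (w - a) * Y\<^sub>b ^ a))"
  show "?R \<in> hom_polys w"
    by (rule hom_poly_in_hom_polys)
  fix Q assume Q: "Q \<in> hom_polys w"
  have "g Q = (\<Sum>b\<le>w. bcoeff Q b (w - b) * g (X\<^sub>b ^ b * Y\<^sub>b ^ (w - b)))"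
    by (subst hom_polys_expand [OF Q]) (rule dual_space_hom_poly [OF g])
  also have "\<dots> = (\<Sum>a\<le>w. bcoeff Q (w - a) a * g (X\<^sub>b ^ (w - a) * Y\<^sub>b ^ a))"
    by (rule sum.reindex_bij_witness [where i = "\<lambda>a. w - a" and j = "\<lambda>a. w - a"]) auto
  also have "\<dots> = pairing w ?R Q"
    unfolding pairing_altdef
    by (intro sum.cong) (auto simp: field_simps simp flip: power_add mult_2)
  finally show "pairing w ?R Q = g Q" ..
qed

text \<open>The projection onto the part of the standard isotypic component, for the copy of \<open>S\<^sub>3\<close> generated
  by \<open>\<gamma>'\<close> and the signed swap, that is fixed by the signed swap.\<close>

definition period_proj :: "rat \<Rightarrow> bipoly \<Rightarrow> bipoly" where
  "period_proj s P = bscale (1 / 6)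
     (bscale 2 P - linsub P 0 1 (-1) (-1) - linsub P (-1) (-1) 1 0
      + (bscale 2 (linsub P 0 s s 0) - linsub P (-s) (-s) 0 s - linsub P s 0 (-s) (-s)))"

lemma beval_period_proj:
  "6 * beval (period_proj s P) u v =
     2 * beval P u v - beval P v (- u - v) - beval P (- u - v) u
     + (2 * beval P (s * v) (s * u) - beval P (s * (- u - v)) (s * v) - beval P (s * u) (s * (- u - v)))"
  by (simp add: period_proj_def algebra_simps)

lemma period_proj_in_hom_polys: "P \<in> hom_polys w \<Longrightarrow> period_proj s P \<in> hom_polys w"
  unfolding period_proj_def
  by (intro hom_polys_add hom_polys_diff hom_polys_scale linsub_in_hom_polys)

lemma period_proj_add: "period_proj s (P + Q) = period_proj s P + period_proj s Q"
  and period_proj_scale: "period_proj s (bscale c P) = bscale c (period_proj s P)"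
  by (intro beval_eqI; simp add: period_proj_def algebra_simps)+

lemma period_proj_in_period_space:
  assumes "P \<in> hom_polys w" "s * s = 1"
  shows "period_proj s P \<in> period_space s w"
proof -
  have s: "s * (s * x) = x" for x
    using assms by (simp flip: mult.assoc)
  let ?R = "period_proj s P"
  have "beval ?R (s * v) (s * u) = beval ?R u v" for u v
    using beval_period_proj [of s P "s * v" "s * u"] beval_period_proj [of s P u v]
    by (simp add: s right_diff_distrib minus_diff_commute)
  moreover have "beval ?R u v + beval ?R v (- u - v) + beval ?R (- u - v) u = 0" for u v
    using beval_period_proj [of s P u v] beval_period_proj [of s P v "- u - v"]
      beval_period_proj [of s P "- u - v" u]
    by simp
  ultimately show ?thesis
    using assms by (simp add: mem_period_space_iff period_proj_in_hom_polys)
qed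

lemma period_proj_eq_self:
  assumes "R \<in> period_space s w"
  shows "period_proj s R = R"
proof (rule beval_eqI)
  fix u v
  have swap: "beval R (s * y) (s * x) = beval R x y"
    and cycle: "beval R x y + beval R y (- x - y) + beval R (- x - y) x = 0" for x y
    using assms by (simp_all add: mem_period_space_iff)
  have "6 * beval (period_proj s R) u v =
      6 * beval R u v - 2 * (beval R u v + beval R v (- u - v) + beval R (- u - v) u)"
    unfolding beval_period_proj swap by simp
  then show "beval (period_proj s R) u v = beval R u v"
    by (simp add: cycle)
qed

lemma pairing_period_proj:
  assumes "P \<in> hom_polys w" "Q \<in> hom_polys w"
  shows "pairing w (period_proj s P) Q = pairing w P (period_proj (- s) Q)"
  using assms
  by (simp add: period_proj_def pairing_add_left pairing_add_right pairing_diff_left pairing_diff_right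
      pairing_scale_left pairing_scale_right pairing_linsub)

lemma period_space_pairing_eqI:
  assumes "s * s = 1" and R: "R \<in> period_space s w" "R' \<in> period_space s w"
    and eq: "\<And>Q. Q \<in> period_space (- s) w \<Longrightarrow> pairing w R Q = pairing w R' Q"
  shows "R = R'"
proof (rule pairing_eqI)
  show hom: "R \<in> hom_polys w" "R' \<in> hom_polys w"
    using R by (simp_all add: period_space_def)
  fix Q assume Q: "Q \<in> hom_polys w"
  have "pairing w R (period_proj (- s) Q) = pairing w R' (period_proj (- s) Q)"
    using assms(1) Q by (intro eq period_proj_in_period_space) simp_all
  then show "pairing w R Q = pairing w R' Q"
    using pairing_period_proj [OF hom(1) Q, of s] pairing_period_proj [OF hom(2) Q, of s]
    by (simp add: period_proj_eq_self [OF R(1)] period_proj_eq_self [OF R(2)])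
qed

lemma period_space_pairing_represents:
  assumes "s * s = 1" and f: "f \<in> dual_space (period_space (- s) w)"
  obtains R where "R \<in> period_space s w"
    "\<And>Q. Q \<in> period_space (- s) w \<Longrightarrow> pairing w R Q = f Q"
proof -
  have proj: "period_proj (- s) Q \<in> period_space (- s) w" if "Q \<in> hom_polys w" for Q
    using assms(1) that by (intro period_proj_in_period_space) simp_all
  have "(\<lambda>Q\<in>hom_polys w. f (period_proj (- s) Q)) \<in> dual_space (hom_polys w)"
    by (intro restrict_in_dual_space hom_polys_subspace)
       (simp_all add: period_proj_add period_proj_scale proj dual_space_add [OF f]
          dual_space_scale [OF f])
  then obtain R where R: "R \<in> hom_polys w"
    "\<And>Q. Q \<in> hom_polys w \<Longrightarrow> pairing w R Q = f (period_proj (- s) Q)"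
    by (rule pairing_represents) simp
  show thesis
  proof
    show "period_proj s R \<in> period_space s w"
      using R(1) assms(1) by (rule period_proj_in_period_space)
    fix Q assume Q: "Q \<in> period_space (- s) w"
    then have "Q \<in> hom_polys w"
      by (simp add: period_space_def)
    then show "pairing w (period_proj s R) Q = f Q"
      using R Q by (simp add: pairing_period_proj period_proj_eq_self)
  qed
qed

lemma iso_to_dual_period_space:
  assumes "s * s = 1"
  shows "iso_to_dual (\<lambda>R. \<lambda>Q\<in>period_space (- s) w. pairing w R Q)
    (period_space s w) (period_space (- s) w)"
proof -
  let ?\<Phi> = "\<lambda>R. \<lambda>Q\<in>period_space (- s) w. pairing w R Q"
  have "inj_on ?\<Phi> (period_space s w)"
  proof (rule inj_onI)
    fix R R' assume R: "R \<in> period_space s w" "R' \<in> period_space s w" and "?\<Phi> R = ?\<Phi> R'"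
    then have "pairing w R Q = pairing w R' Q" if "Q \<in> period_space (- s) w" for Q
      using that by (metis restrict_apply')
    then show "R = R'"
      by (rule period_space_pairing_eqI [OF assms R])
  qed
  moreover have "?\<Phi> R \<in> dual_space (period_space (- s) w)" for R
    by (intro restrict_in_dual_space period_space_subspace pairing_add_right pairing_scale_right)
  moreover have "f \<in> ?\<Phi> ` period_space s w" if f: "f \<in> dual_space (period_space (- s) w)" for f
  proof -
    obtain R where "R \<in> period_space s w"
      "\<And>Q. Q \<in> period_space (- s) w \<Longrightarrow> pairing w R Q = f Q"
      using period_space_pairing_represents [OF assms f] by blast
    moreover have "f \<in> extensional (period_space (- s) w)"
      using f by (simp add: dual_space_def)
    ultimately show ?thesis
      by (intro image_eqI [of _ _ R] extensionalityI [of f]) auto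
  qed
  ultimately have "bij_betw ?\<Phi> (period_space s w) (dual_space (period_space (- s) w))"
    unfolding bij_betw_def by blast
  then show ?thesis
    by (simp add: iso_to_dual_def pairing_add_left pairing_scale_left cong: restrict_cong)
qed

lemma iso_to_dual_comp:
  assumes \<Phi>: "iso_to_dual \<Phi> L U" and h: "bij_betw h L' L"
    and "\<And>P Q. h (P + Q) = h P + h Q" "\<And>c P. h (bscale c P) = bscale c (h P)"
  shows "iso_to_dual (\<lambda>P. \<Phi> (h P)) L' U"
proof -
  have "h P \<in> L" if "P \<in> L'" for P
    using h that by (rule bij_betwE [THEN bspec])
  then show ?thesis
    using \<Phi> bij_betw_trans [OF h] assms(3,4) by (auto simp: iso_to_dual_def o_def)
qed

lemma iso_to_dual_twisted_pairing:
  "iso_to_dual (\<lambda>P. \<lambda>Q\<in>W_space w. twisted_pairing w P Q) (LSh2 w) (W_space w)"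
  using iso_to_dual_comp [OF iso_to_dual_period_space [of 1] bij_betw_act_delta
      act_delta_add act_delta_scale]
  by (simp add: twisted_pairing_def W_space_eq_period_space)

theorem theorem5p3:
  fixes w :: nat
  shows "(even w \<longrightarrow> bij_betw (\<lambda>P. act P mat_delta) (LSh2 w) (W_space w)) \<and>
         (odd w \<longrightarrow>
            iso_to_dual (\<lambda>P. \<lambda>Q\<in>W_space w. twisted_pairing w P Q) (LSh2 w) (W_space w)) \<and>
         bipoly.dim (LSh2 w) = (w + 2) div 3"
proof (intro conjI impI)
  assume "even w"
  then have "W_space w = period_space 1 w"
    by (simp add: W_space_eq_period_space period_space_uminus_even)
  then show "bij_betw (\<lambda>P. act P mat_delta) (LSh2 w) (W_space w)"
    by (simp add: bij_betw_act_delta)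
next
  show "iso_to_dual (\<lambda>P. \<lambda>Q\<in>W_space w. twisted_pairing w P Q) (LSh2 w) (W_space w)"
    by (rule iso_to_dual_twisted_pairing)
  show "bipoly.dim (LSh2 w) = (w + 2) div 3"
    by (rule dim_LSh2)
qed

end
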